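(* Let $n\ge2$ and $1\le k\le n-1$. Let $W=S_n$ with simple reflections $S=\{s_1,\dots,s_{n-1}\}$, $s_i=(i\ \,i+1)$, let $J=S\setminus\{s_k\}$, let $w\in W^J$ be a Grassmannian permutation, let $m=\ell(w)$, and let $\lambda=\lambda(w)$ be its associated shape. To each valid firing sequence $(i_1,\dots,i_m)$ of the Modified Kostant Game on the Dynkin diagram $A_{n-1}$ with active set $I=\{k\}$ that produces $w$ (i.e. $s_{i_m}\cdots s_{i_1}=w$), assign a filling as follows: start from the empty shape, and for $j=1,\dots,m$ successively place the integer $j$ in the unique addable cell $(r,c)$ of the shape formed by the cells filled so far that satisfies $c-r=i_j-k$. Then this step-by-step procedure is well defined and constitutes a bijection from the set of valid firing sequences producing $w$ onto the set $\mathrm{SYT}(\lambda)$ of Standard Young Tableaux of shape $\lambda$.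
   Context: $W^J=\{w\in S_n:\ell(ws_j)>\ell(w)\text{ for all }j\ne k\}$ is the set of minimal length representatives of the left cosets $S_n/(S_k\times S_{n-k})$; its elements, called Grassmannian permutations, are the $w$ with $w(1)<\cdots<w(k)$ and $w(k+1)<\cdots<w(n)$. The shape associated with $w\in W^J$ is the partition $\lambda(w)=(w(k)-k,\;w(k-1)-(k-1),\;\dots,\;w(1)-1)$ (zero parts dropped), whose Young diagram fits in a $k\times(n-k)$ rectangle and has $\ell(w)$ cells. Cells are denoted $(r,c)$ with row $r$ counted from top to bottom and column $c$ from left to right (English notation). An addable cell of a Young diagram is a cell not in the diagram whose addition gives again a Young diagram. A Standard Young Tableau of shape $\lambda$ with $m$ cells is a bijective filling by $1,\dots,m$ that strictly increases along rows and down columns. Modified Kostant Game on $A_{n-1}$ with active set $\{k\}$: the vertices are $1,\dots,n-1$, with $i$ and $i'$ adjacent iff $|i-i'|=1$. A configuration is $c=(c_1,\dots,c_{n-1})\in\mathbb Z_{\ge0}^{n-1}$; set $c_0=c_n=0$. With $\epsilon_v=1$ if $v=k$ and $\epsilon_v=0$ otherwise, vertex $v$ is sad if $c_v<\tfrac12(c_{v-1}+c_{v+1}+\epsilon_v)$; firing a sad vertex $v$ replaces $c_v$ by $c_{v-1}+c_{v+1}+\epsilon_v-c_v$ and leaves the other entries unchanged. The game starts from the zero configuration. A sequence $(i_1,\dots,i_m)$ is a valid firing sequence if each $i_j$ is sad at the moment it is fired when $i_1,\dots,i_m$ are fired successively starting from $\mathbf 0$. *)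

theory Defs
  imports Complex_Main "HOL-Combinatorics.Permutations"
begin

section \<open>The symmetric group and Grassmannian permutations\<close>

text \<open>
  \<open>S\<^sub>n\<close> is the set of \<open>w\<close> with \<open>w permutes {1..n}\<close>; the product \<open>u v\<close> is \<open>u \<circ> v\<close>, so
  that \<open>(w s\<^sub>j)(i) = w (s\<^sub>j i)\<close>.
\<close>

definition simple_refl :: "nat \<Rightarrow> nat \<Rightarrow> nat" where
  "simple_refl i = transpose i (i + 1)"

definition word_prod :: "nat list \<Rightarrow> nat \<Rightarrow> nat" where
  "word_prod vs = foldr (\<lambda>i p. simple_refl i \<circ> p) vs id"

definition cox_length :: "nat \<Rightarrow> (nat \<Rightarrow> nat) \<Rightarrow> nat" where
  "cox_length n w =
     (LEAST m. \<exists>vs. set vs \<subseteq> {1..n - 1} \<and> length vs = m \<and> word_prod vs = w)"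

definition grassmannian :: "nat \<Rightarrow> nat \<Rightarrow> (nat \<Rightarrow> nat) set" where
  "grassmannian n k =
     {w. w permutes {1..n} \<and>
         (\<forall>j\<in>{1..n - 1} - {k}. cox_length n (w \<circ> simple_refl j) > cox_length n w)}"

text \<open>
  The list below is \<open>(w(k) - k, \<dots>, w(1) - 1)\<close> with zeros dropped.  Truncated subtraction is
  harmless: \<open>w(1) < \<dots> < w(k)\<close> gives \<open>w(i) \<ge> i\<close> for \<open>i \<le> k\<close>.
\<close>

definition shape :: "nat \<Rightarrow> (nat \<Rightarrow> nat) \<Rightarrow> nat list" where
  "shape k w = filter (\<lambda>p. p \<noteq> 0) (map (\<lambda>i. w i - i) (rev [1..<k + 1]))"

section \<open>Young diagrams and standard Young tableaux\<close>

definition is_partition :: "nat list \<Rightarrow> bool" where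
  "is_partition \<mu> \<longleftrightarrow> sorted_wrt (\<ge>) \<mu> \<and> 0 \<notin> set \<mu>"

text \<open>Cells are pairs (row, column), both counted from 1; list entries are indexed from 0.\<close>

definition diagram :: "nat list \<Rightarrow> (nat \<times> nat) set" where
  "diagram \<mu> = {(r, c). 1 \<le> r \<and> r \<le> length \<mu> \<and> 1 \<le> c \<and> c \<le> \<mu> ! (r - 1)}"

definition young_diagram :: "(nat \<times> nat) set \<Rightarrow> bool" where
  "young_diagram D \<longleftrightarrow> (\<exists>\<mu>. is_partition \<mu> \<and> D = diagram \<mu>)"

definition addable :: "(nat \<times> nat) set \<Rightarrow> nat \<times> nat \<Rightarrow> bool" where
  "addable D x \<longleftrightarrow> young_diagram D \<and> x \<notin> D \<and> young_diagram (insert x D)"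

definition content :: "nat \<times> nat \<Rightarrow> int" where
  "content x = int (snd x) - int (fst x)"

text \<open>
  Fillings are partial maps from cells to numbers, so that a tableau carries no junk values
  outside its shape.
\<close>

definition SYT :: "nat list \<Rightarrow> (nat \<times> nat \<rightharpoonup> nat) set" where
  "SYT \<mu> =
     {T. dom T = diagram \<mu> \<and>
         bij_betw (\<lambda>x. the (T x)) (diagram \<mu>) {1..card (diagram \<mu>)} \<and>
         (\<forall>r c c'. (r, c) \<in> diagram \<mu> \<and> (r, c') \<in> diagram \<mu> \<and> c < c' \<longrightarrow>
            the (T (r, c)) < the (T (r, c'))) \<and>
         (\<forall>r r' c. (r, c) \<in> diagram \<mu> \<and> (r', c) \<in> diagram \<mu> \<and> r < r' \<longrightarrow>
            the (T (r, c)) < the (T (r', c)))}"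

section \<open>The modified Kostant game on \<open>A\<^bsub>n-1\<^esub>\<close> with active set \<open>{k}\<close>\<close>

text \<open>
  A configuration is a function on all naturals.  Only vertices in \<open>{1..n - 1}\<close> can fire, so
  a game started from zero keeps the boundary values \<open>c 0 = c n = 0\<close>.
\<close>

definition nbr_sum :: "nat \<Rightarrow> (nat \<Rightarrow> nat) \<Rightarrow> nat \<Rightarrow> nat" where
  "nbr_sum k c v = c (v - 1) + c (v + 1) + (if v = k then 1 else 0)"

definition sad :: "nat \<Rightarrow> nat \<Rightarrow> (nat \<Rightarrow> nat) \<Rightarrow> nat \<Rightarrow> bool" where
  "sad n k c v \<longleftrightarrow> v \<in> {1..n - 1} \<and> real (c v) < real (nbr_sum k c v) / 2"

text \<open>For a sad vertex \<open>nbr_sum k c v > c v\<close>, so the subtraction does not truncate.\<close>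

definition fire :: "nat \<Rightarrow> nat \<Rightarrow> (nat \<Rightarrow> nat) \<Rightarrow> (nat \<Rightarrow> nat)" where
  "fire k v c = c(v := nbr_sum k c v - c v)"

fun valid_from :: "nat \<Rightarrow> nat \<Rightarrow> (nat \<Rightarrow> nat) \<Rightarrow> nat list \<Rightarrow> bool" where
  "valid_from n k c [] = True"
| "valid_from n k c (v # vs) = (sad n k c v \<and> valid_from n k (fire k v c) vs)"

definition valid_firing :: "nat \<Rightarrow> nat \<Rightarrow> nat list \<Rightarrow> bool" where
  "valid_firing n k vs = valid_from n k (\<lambda>_. 0) vs"

text \<open>\<open>(i\<^sub>1, \<dots>, i\<^sub>m)\<close> produces \<open>s\<^bsub>i\<^sub>m\<^esub> \<cdots> s\<^bsub>i\<^sub>1\<^esub>\<close>, hence the reversal.\<close>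

definition firing_seqs :: "nat \<Rightarrow> nat \<Rightarrow> (nat \<Rightarrow> nat) \<Rightarrow> nat list set" where
  "firing_seqs n k w =
     {vs. length vs = cox_length n w \<and> valid_firing n k vs \<and> word_prod (rev vs) = w}"

section \<open>The filling attached to a firing sequence\<close>

definition next_cell :: "nat \<Rightarrow> nat \<Rightarrow> (nat \<times> nat) set \<Rightarrow> nat \<times> nat \<Rightarrow> bool" where
  "next_cell k i D x \<longleftrightarrow> addable D x \<and> content x = int i - int k"

text \<open>
  \<open>filling_upto k vs j\<close> is the filling after \<open>j\<close> steps; \<open>vs ! j\<close> is the \<open>(j+1)\<close>-st entry of
  the sequence.  The value is meaningful only if the chosen cell exists uniquely at each step.
\<close>

fun filling_upto :: "nat \<Rightarrow> nat list \<Rightarrow> nat \<Rightarrow> (nat \<times> nat \<rightharpoonup> nat)" where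
  "filling_upto k vs 0 = Map.empty"
| "filling_upto k vs (Suc j) =
     (let T = filling_upto k vs j
      in T((THE x. next_cell k (vs ! j) (dom T) x) \<mapsto> Suc j))"

definition filling :: "nat \<Rightarrow> nat list \<Rightarrow> (nat \<times> nat \<rightharpoonup> nat)" where
  "filling k vs = filling_upto k vs (length vs)"

end

theory Submission
  imports Defs
begin

text \<open>
  Let \<open>u = s\<^bsub>i\<^sub>j\<^esub> \<cdots> s\<^bsub>i\<^sub>1\<^esub>\<close> after \<open>j\<close> steps and \<open>A = u ` {1..k}\<close>.  The configuration is then
  \<open>c\<^sub>v = min k v - card (A \<inter> {1..v})\<close>, whose second difference shows that \<open>v\<close> is sad exactly when
  \<open>v \<in> A\<close> and \<open>v + 1 \<notin> A\<close>.  In that case left multiplication by \<open>s\<^sub>v\<close> replaces \<open>v\<close> by \<open>v + 1\<close>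
  in \<open>A\<close>, keeps \<open>u\<close> increasing on both blocks, creates one inversion, and lengthens the row of the
  diagram belonging to \<open>i = u\<^sup>-\<^sup>1 v\<close> by the cell \<open>(k + 1 - i, v + 1 - i)\<close> of content \<open>v - k\<close>.  Two
  addable cells never have the same content, so the filling is well defined, and the contents of
  its cells recover the firing sequence.  Conversely, the cell of the largest entry of a tableau
  is always the one created by a last legal firing, so every tableau arises by induction.
\<close>

section \<open>Coxeter length and inversions\<close>

text \<open>Pairs are taken by position, so that left multiplication by
  \<open>simple_refl v\<close>, which acts on values, leaves the index pairs comparable.\<close>

definition inversions :: "nat \<Rightarrow> (nat \<Rightarrow> nat) \<Rightarrow> (nat \<times> nat) set" where
  "inversions n u = {(i, j). i \<in> {1..n} \<and> j \<in> {1..n} \<and> i < j \<and> u j < u i}"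

lemma finite_inversions: "finite (inversions n u)"
  by (rule finite_subset[of _ "{1..n} \<times> {1..n}"]) (auto simp: inversions_def)

lemma simple_refl_left [simp]: "simple_refl v v = Suc v"
  and simple_refl_right [simp]: "simple_refl v (Suc v) = v"
  by (simp_all add: simple_refl_def)

lemma simple_refl_involutory [simp]: "simple_refl v (simple_refl v a) = a"
  by (simp add: simple_refl_def)

lemma simple_refl_comp_comp [simp]: "simple_refl v \<circ> (simple_refl v \<circ> u) = u"
  by (simp add: fun_eq_iff)

text \<open>No integer lies strictly between \<open>v\<close> and \<open>v + 1\<close>, so
  exchanging them disturbs the order of that single pair.\<close>

lemma simple_refl_less:
  assumes "a < b" "\<not> (a = v \<and> b = v + 1)"
  shows "simple_refl v a < simple_refl v b"
  using assms by (auto simp: simple_refl_def transpose_def)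

lemma simple_refl_comp_permutes:
  assumes "v \<in> {1..n - 1}" "u permutes {1..n}"
  shows "simple_refl v \<circ> u permutes {1..n}"
  unfolding simple_refl_def using assms
  by (intro permutes_compose permutes_swap_id) auto

lemma word_prod_Cons: "word_prod (v # vs) = simple_refl v \<circ> word_prod vs"
  by (simp add: word_prod_def)

lemma word_prod_Nil: "word_prod [] = id"
  by (simp add: word_prod_def)

lemma inversions_id: "inversions n id = {}"
  by (auto simp: inversions_def)

lemma word_prod_permutes: "set vs \<subseteq> {1..n - 1} \<Longrightarrow> word_prod vs permutes {1..n}"
proof (induction vs)
  case Nil
  show ?case unfolding word_prod_Nil by (rule permutes_id)
next
  case (Cons v vs)
  then show ?case unfolding word_prod_Cons by (intro simple_refl_comp_permutes) auto
qed

text \<open>Only the pair of positions carrying \<open>v\<close> and \<open>v + 1\<close> changes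
  its relative order, and \<open>p < q\<close> means that it was not yet an inversion.\<close>

lemma card_inversions_simple_refl:
  assumes u: "u permutes {1..n}" and pq: "p \<in> {1..n}" "q \<in> {1..n}" "p < q" "u p = v" "u q = v + 1"
  shows "card (inversions n (simple_refl v \<circ> u)) = Suc (card (inversions n u))"
proof -
  have inj: "u i = u j \<longleftrightarrow> i = j" for i j
    using permutes_inj[OF u] by (simp add: inj_eq)
  have *: "simple_refl v (u j) < simple_refl v (u i) \<longleftrightarrow> u j < u i \<or> (i, j) = (p, q)" if "i < j" for i j
  proof (cases "(i, j) = (p, q)")
    case True
    then show ?thesis using pq by (simp add: simple_refl_def)
  next
    case False
    have "\<not> (u j = v \<and> u i = v + 1)" "\<not> (u i = v \<and> u j = v + 1)"
      using False that pq inj by (metis less_asym)+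
    moreover have "u i \<noteq> u j" using inj that by simp
    ultimately show ?thesis
      using simple_refl_less[of "u i" "u j" v] simple_refl_less[of "u j" "u i" v] False by fastforce
  qed
  have "inversions n (simple_refl v \<circ> u) = insert (p, q) (inversions n u)"
    unfolding inversions_def using * pq by auto
  moreover have "(p, q) \<notin> inversions n u"
    using pq by (simp add: inversions_def)
  ultimately show ?thesis by (simp add: finite_inversions)
qed

text \<open>If \<open>v + 1\<close> stands to the left of \<open>v\<close>, the exact count applied
  to \<open>simple_refl v \<circ> u\<close> shows that the number drops by one instead.\<close>

lemma card_inversions_simple_refl_le:
  assumes u: "u permutes {1..n}" and v: "v \<in> {1..n - 1}"
  shows "card (inversions n (simple_refl v \<circ> u)) \<le> Suc (card (inversions n u))"
proof -
  have "v \<in> u ` {1..n}" "v + 1 \<in> u ` {1..n}"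
    using v permutes_image[OF u] by auto
  then obtain p q where pq: "p \<in> {1..n}" "u p = v" "q \<in> {1..n}" "u q = v + 1" by force
  have "p \<noteq> q" using pq by auto
  then consider "p < q" | "q < p" by linarith
  then show ?thesis
  proof cases
    case 1
    then show ?thesis using card_inversions_simple_refl[OF u] pq by simp
  next
    case 2
    have "card (inversions n (simple_refl v \<circ> (simple_refl v \<circ> u)))
        = Suc (card (inversions n (simple_refl v \<circ> u)))"
      by (rule card_inversions_simple_refl[OF simple_refl_comp_permutes[OF v u] pq(3) pq(1) 2])
         (use pq in simp_all)
    then show ?thesis by simp
  qed
qed

text \<open>Each letter adds at most one inversion. This is the lower bound for the Coxeter
  length.\<close>

lemma card_inversions_word_prod_le:
  "set vs \<subseteq> {1..n - 1} \<Longrightarrow> card (inversions n (word_prod vs)) \<le> length vs"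
proof (induction vs)
  case Nil
  show ?case unfolding word_prod_Nil inversions_id by simp
next
  case (Cons v vs)
  then have "card (inversions n (simple_refl v \<circ> word_prod vs)) \<le> Suc (length vs)"
    using card_inversions_simple_refl_le[of "word_prod vs" n v] word_prod_permutes[of vs n] by simp
  then show ?case by (simp only: word_prod_Cons list.size add_0_right add_Suc_right)
qed

text \<open>Strong induction: the preimage of \<open>i\<close> is not below \<open>i\<close>, where
  all points are fixed; if it were above, \<open>u i < i\<close> would be a fixed point, against
  injectivity.\<close>

lemma strict_mono_permutes_imp_id:
  fixes u :: "nat \<Rightarrow> nat"
  assumes u: "u permutes {1..n}" and mono: "strict_mono_on {1..n} u"
  shows "u = id"
proof -
  have "i \<in> {1..n} \<Longrightarrow> u i = i" for i
  proof (induction i rule: less_induct)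
    case (less i)
    obtain j where j: "j \<in> {1..n}" "u j = i"
      using permutes_image[OF u] less.prems by (metis imageE)
    have "\<not> j < i" using less.IH[of j] j by auto
    moreover have "\<not> i < j"
    proof
      assume "i < j"
      then have "u i < i" using strict_mono_onD[OF mono less.prems j(1)] j by simp
      then have "u (u i) = u i" using less.IH[of "u i"] permutes_in_image[OF u] less.prems by blast
      then have "u i = i" using permutes_inj[OF u] by (simp add: inj_eq)
      then show False using \<open>u i < i\<close> by simp
    qed
    ultimately show ?case using j by simp
  qed
  then show ?thesis using permutes_not_in[OF u] by (metis eq_id_iff)
qed

lemma strict_mono_on_atLeastAtMostI:
  fixes u :: "nat \<Rightarrow> nat"
  assumes "\<And>i. a \<le> i \<Longrightarrow> i < b \<Longrightarrow> u i < u (Suc i)"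
  shows "strict_mono_on {a..b} u"
proof (rule strict_mono_onI)
  fix i j assume "i \<in> {a..b}" "j \<in> {a..b}" "i < j"
  then have "Suc i \<le> j" "j \<le> b" "a \<le> i" by auto
  then show "u i < u j"
    by (induction j rule: dec_induct) (use assms in \<open>force intro: less_trans\<close>)+
qed

text \<open>The upper bound for the Coxeter length, as in bubble sort: unless \<open>w\<close> is
  the identity, some adjacent values \<open>v\<close>, \<open>v + 1\<close> appear in the wrong
  order, and exchanging them removes one inversion.\<close>

lemma ex_word_of_card_inversions:
  "w permutes {1..n} \<Longrightarrow>
    \<exists>vs. set vs \<subseteq> {1..n - 1} \<and> length vs = card (inversions n w) \<and> word_prod vs = w"
proof (induction "card (inversions n w)" arbitrary: w rule: less_induct)
  case less
  show ?case
  proof (cases "strict_mono_on {1..n} (inv w)")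
    case True
    then have "inv w = id" using strict_mono_permutes_imp_id permutes_inv[OF less.prems] by blast
    then have "w = id" using permutes_inv_inv[OF less.prems] by (metis inv_id)
    then show ?thesis using inversions_id word_prod_Nil by (intro exI[of _ "[]"]) auto
  next
    case False
    then obtain v where v: "1 \<le> v" "v < n" "\<not> inv w v < inv w (Suc v)"
      using strict_mono_on_atLeastAtMostI by blast
    define p q where "p = inv w v" and "q = inv w (Suc v)"
    have w': "inv w permutes {1..n}" by (rule permutes_inv[OF less.prems])
    have pq: "w p = v" "w q = v + 1" "p \<in> {1..n}" "q \<in> {1..n}"
      using v permutes_inverses(1)[OF less.prems] permutes_in_image[OF w']
      by (auto simp: p_def q_def)
    then have "q < p" using v unfolding p_def[symmetric] q_def[symmetric]
      by (metis linorder_neqE_nat n_not_Suc_n Suc_eq_plus1)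
    have vn: "v \<in> {1..n - 1}" using v by auto
    note perm = simple_refl_comp_permutes[OF vn less.prems]
    \<comment> \<open>In \<open>simple_refl v \<circ> w\<close> the values \<open>v\<close> and
      \<open>v + 1\<close> stand at \<open>q < p\<close>, so returning to \<open>w\<close> adds one
      inversion.\<close>
    have card: "card (inversions n w) = Suc (card (inversions n (simple_refl v \<circ> w)))"
      using card_inversions_simple_refl[OF perm pq(4) pq(3) \<open>q < p\<close>, of v] pq
      by simp
    then obtain vs where "set vs \<subseteq> {1..n - 1}" "length vs = card (inversions n (simple_refl v \<circ> w))"
        "word_prod vs = simple_refl v \<circ> w"
      using less.hyps[OF _ perm] by auto
    then show ?thesis using vn card
      by (intro exI[of _ "v # vs"]) (auto simp: word_prod_Cons)
  qed
qed

lemma cox_length_eq_card_inversions: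
  assumes "w permutes {1..n}"
  shows "cox_length n w = card (inversions n w)"
  unfolding cox_length_def
proof (rule Least_equality)
  show "\<exists>vs. set vs \<subseteq> {1..n - 1} \<and> length vs = card (inversions n w) \<and> word_prod vs = w"
    by (rule ex_word_of_card_inversions[OF assms])
qed (use card_inversions_word_prod_le in blast)

text \<open>An inversion read by its two values instead of its two positions is an inversion of the
  inverse. This turns right multiplication into left multiplication.\<close>

lemma card_inversions_inv:
  assumes w: "w permutes {1..n}"
  shows "card (inversions n (inv w)) = card (inversions n w)"
proof (rule bij_betw_same_card[symmetric])
  show "bij_betw (\<lambda>(i, j). (w j, w i)) (inversions n w) (inversions n (inv w))"
    by (rule bij_betw_byWitness[where f' = "\<lambda>(i, j). (inv w j, inv w i)"])
       (use permutes_in_image[OF w] permutes_in_image[OF permutes_inv[OF w]] permutes_inverses[OF w]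
         in \<open>auto simp: inversions_def\<close>)
qed

section \<open>Grassmannian permutations as permutations increasing on two blocks\<close>

definition increasing_blocks :: "nat \<Rightarrow> nat \<Rightarrow> (nat \<Rightarrow> nat) \<Rightarrow> bool" where
  "increasing_blocks n k u \<longleftrightarrow>
     u permutes {1..n} \<and> strict_mono_on {1..k} u \<and> strict_mono_on {k + 1..n} u"

text \<open>A descent at \<open>j\<close> would make \<open>w \<circ> simple_refl j\<close> shorter
  than \<open>w\<close>. Inversions are counted for left multiplication, so the argument runs
  through the inverses.\<close>

lemma grassmannian_imp_ascent:
  assumes w: "w \<in> grassmannian n k" and j: "j \<in> {1..n - 1} - {k}"
  shows "w j < w (Suc j)"
proof (rule ccontr)
  assume "\<not> w j < w (Suc j)"
  have p: "w permutes {1..n}" using w by (simp add: grassmannian_def)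
  have "w j \<noteq> w (Suc j)" using permutes_inj[OF p] by (simp add: inj_eq)
  then have less: "w (Suc j) < w j" using \<open>\<not> w j < w (Suc j)\<close> by simp
  have j': "j \<in> {1..n - 1}" using j by simp
  \<comment> \<open>The inverse of \<open>w \<circ> simple_refl j\<close>; it carries
    \<open>j\<close> and \<open>j + 1\<close> at the positions
    \<open>w (Suc j) < w j\<close>.\<close>
  define x where "x = simple_refl j \<circ> inv w"
  have x: "x permutes {1..n}"
    unfolding x_def by (rule simple_refl_comp_permutes[OF j' permutes_inv[OF p]])
  have winv: "inv w (w a) = a" for a using permutes_inverses(2)[OF p] .
  have "card (inversions n (simple_refl j \<circ> x)) = Suc (card (inversions n x))"
  proof (rule card_inversions_simple_refl[OF x _ _ less])
    show "w (Suc j) \<in> {1..n}" "w j \<in> {1..n}"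
      unfolding permutes_in_image[OF p] using j' by auto
    show "x (w (Suc j)) = j" "x (w j) = j + 1"
      by (simp_all add: x_def winv)
  qed
  then have "card (inversions n (inv w)) = Suc (card (inversions n x))"
    by (simp add: x_def)
  moreover have "w \<circ> simple_refl j = inv x"
    unfolding x_def
    by (rule inv_unique_comp[symmetric])
       (simp_all add: fun_eq_iff permutes_inverses[OF p])
  ultimately have "card (inversions n (w \<circ> simple_refl j)) < card (inversions n w)"
    using card_inversions_inv[OF p] card_inversions_inv[OF x] by simp
  moreover have "w \<circ> simple_refl j permutes {1..n}"
    using \<open>w \<circ> simple_refl j = inv x\<close> permutes_inv[OF x] by simp
  ultimately have "cox_length n (w \<circ> simple_refl j) < cox_length n w"
    using cox_length_eq_card_inversions p by simp
  then show False using w j by (force simp: grassmannian_def)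
qed

lemma grassmannian_imp_increasing_blocks:
  assumes w: "w \<in> grassmannian n k" and "k \<le> n - 1"
  shows "increasing_blocks n k w"
  unfolding increasing_blocks_def
proof (intro conjI strict_mono_on_atLeastAtMostI)
  show "w permutes {1..n}" using w by (simp add: grassmannian_def)
qed (use grassmannian_imp_ascent[OF w] assms in auto)

text \<open>Monotonicity on a block could fail only if \<open>v\<close> and \<open>v + 1\<close>
  were both values of that block. The condition is symmetric in the two values, so it covers a move
  as well as its undoing.\<close>

lemma increasing_blocks_simple_refl:
  assumes u: "increasing_blocks n k u" and v: "v \<in> {1..n - 1}"
    and *: "v \<in> u ` {1..k} \<longleftrightarrow> v + 1 \<notin> u ` {1..k}"
  shows "increasing_blocks n k (simple_refl v \<circ> u)"
proof -
  have p: "u permutes {1..n}" using u by (simp add: increasing_blocks_def)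
  have inj: "u i = u j \<longleftrightarrow> i = j" for i j
    using permutes_inj[OF p] by (simp add: inj_eq)
  have mono: "strict_mono_on {a..b} (simple_refl v \<circ> u)"
    if "strict_mono_on {a..b} u" "\<not> (v \<in> u ` {a..b} \<and> v + 1 \<in> u ` {a..b})" for a b
  proof (rule strict_mono_onI)
    fix i j assume ij: "i \<in> {a..b}" "j \<in> {a..b}" "i < j"
    have "u i < u j" using strict_mono_onD[OF that(1) ij] .
    moreover have "\<not> (u i = v \<and> u j = v + 1)" using that ij by (metis imageI)
    ultimately show "(simple_refl v \<circ> u) i < (simple_refl v \<circ> u) j"
      using simple_refl_less by simp
  qed
  have "\<not> (v \<in> u ` {k + 1..n} \<and> v + 1 \<in> u ` {k + 1..n})"
  proof
    assume "v \<in> u ` {k + 1..n} \<and> v + 1 \<in> u ` {k + 1..n}"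
    then have "v \<notin> u ` {1..k}" "v + 1 \<notin> u ` {1..k}"
      using inj by (auto simp: image_iff)
    then show False using * by simp
  qed
  then show ?thesis
    using u * mono simple_refl_comp_permutes[OF v p] unfolding increasing_blocks_def by blast
qed

lemma increasing_blocks_ge:
  assumes u: "increasing_blocks n k u"
  shows "i \<le> k \<Longrightarrow> i \<le> u i"
proof (induction i)
  case (Suc i)
  show ?case
  proof (cases "i = 0")
    \<comment> \<open>Since 0 lies outside \<open>{1..n}\<close> it is fixed, and injectivity keeps
      \<open>u 1\<close> away from 0.\<close>
    case True
    have "u permutes {1..n}" using u by (simp add: increasing_blocks_def)
    then have "u 0 = 0" "u 1 \<noteq> u 0"
      using permutes_not_in[of u "{1..n}" 0] permutes_inj[of u "{1..n}"] inj_eq[of u 1 0] by simp_all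
    then show ?thesis using True by simp
  next
    case False
    then have "u i < u (Suc i)" using u Suc.prems
        strict_mono_onD[of "{1..k}" u] by (simp add: increasing_blocks_def)
    then show ?thesis using Suc by simp
  qed
qed simp

section \<open>The game in terms of the permutation\<close>

text \<open>
  The number of cells of content \<open>v - k\<close>: the row \<open>k + 1 - i\<close> has such a cell iff
  \<open>i \<le> v < u i\<close>, and \<open>u i \<le> v\<close> forces \<open>i \<le> v\<close>.
\<close>

definition config :: "nat \<Rightarrow> (nat \<Rightarrow> nat) \<Rightarrow> nat \<Rightarrow> nat" where
  "config k u v = min k v - card {i \<in> {1..k}. u i \<le> v}"

text \<open>The subtraction in \<open>config\<close> does not truncate: the counted positions lie in
  \<open>{1..k}\<close>, and \<open>u\<close> injects them into \<open>{1..v}\<close>.\<close>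

lemma card_values_le:
  assumes "u permutes {1..n}" "k \<le> n"
  shows "card {i \<in> {1..k}. u i \<le> v} \<le> min k v"
proof -
  have "card {i \<in> {1..k}. u i \<le> v} \<le> card {1..k}" by (rule card_mono) auto
  moreover have "card {i \<in> {1..k}. u i \<le> v} \<le> card {1..v}"
  proof (rule card_inj_on_le)
    show "inj_on u {i \<in> {1..k}. u i \<le> v}" using permutes_inj_on[OF assms(1)] .
    show "u ` {i \<in> {1..k}. u i \<le> v} \<subseteq> {1..v}"
      using permutes_in_image[OF assms(1)] assms(2) by fastforce
  qed simp
  ultimately show ?thesis by simp
qed

text \<open>The first difference of the count is an indicator, because at most one position carries
  the value \<open>Suc v\<close>.\<close>

lemma card_values_le_Suc:
  fixes u :: "nat \<Rightarrow> nat"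
  assumes "inj u"
  shows "card {i \<in> {1..k}. u i \<le> Suc v} =
    card {i \<in> {1..k}. u i \<le> v} + (if Suc v \<in> u ` {1..k} then 1 else 0)"
proof (cases "Suc v \<in> u ` {1..k}")
  case True
  then obtain i where i: "i \<in> {1..k}" "u i = Suc v" by force
  then have "{i \<in> {1..k}. u i \<le> Suc v} = insert i {i \<in> {1..k}. u i \<le> v}"
    using assms by (auto simp: le_Suc_eq inj_eq) (metis assms inj_eq)+
  moreover have "i \<notin> {i \<in> {1..k}. u i \<le> v}" using i by simp
  moreover have "finite {i \<in> {1..k}. u i \<le> v}" by simp
  ultimately have "card {i \<in> {1..k}. u i \<le> Suc v} = Suc (card {i \<in> {1..k}. u i \<le> v})"
    by (metis card_insert_disjoint)
  then show ?thesis using True by simp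
next
  case False
  then have "u i \<noteq> Suc v" if "i \<in> {1..k}" for i using that by (metis imageI)
  then have "{i \<in> {1..k}. u i \<le> Suc v} = {i \<in> {1..k}. u i \<le> v}"
    by (auto simp: le_Suc_eq)
  then show ?thesis using False by simp
qed

text \<open>The summand for the active vertex cancels the kink of \<open>min k v\<close> at \<open>v = k\<close>.\<close>

lemma nbr_sum_config:
  assumes u: "u permutes {1..n}" and k: "k \<le> n" and v: "1 \<le> v"
  shows "nbr_sum k (config k u) v + (if v + 1 \<in> u ` {1..k} then 1 else 0)
       = 2 * config k u v + (if v \<in> u ` {1..k} then 1 else 0)"
proof -
  obtain x where x: "v = Suc x" using v by (cases v) auto
  \<comment> \<open>These bounds at \<open>v - 1\<close>, \<open>v\<close> and \<open>v + 1\<close>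
    let the truncated differences be treated as integer ones.\<close>
  note le = card_values_le[OF u k]
  show ?thesis
    using le[of x] le[of v] le[of "v + 1"] card_values_le_Suc[OF permutes_inj[OF u], of k x]
      card_values_le_Suc[OF permutes_inj[OF u], of k v]
    unfolding nbr_sum_def config_def x by (auto simp: min_def split: if_splits)
qed

text \<open>By \<open>nbr_sum_config\<close>, the neighbour sum minus twice the entry at
  \<open>v\<close> is the indicator of \<open>v\<close> minus that of \<open>v + 1\<close>; it is
  positive only as 1 - 0.\<close>

lemma sad_config_iff:
  assumes "u permutes {1..n}" "k \<le> n"
  shows "sad n k (config k u) v \<longleftrightarrow> v \<in> {1..n - 1} \<and> v \<in> u ` {1..k} \<and> v + 1 \<notin> u ` {1..k}"
proof (cases "v \<in> {1..n - 1}")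
  case True
  then show ?thesis using nbr_sum_config[OF assms, of v] unfolding sad_def
    by (auto split: if_splits)
qed (auto simp: sad_def)

text \<open>For \<open>x \<noteq> v\<close> the exchange of \<open>v\<close> and
  \<open>v + 1\<close> does not cross the threshold \<open>x\<close>. At \<open>v\<close> itself one
  position leaves the count, and firing raises the entry by one.\<close>

lemma fire_config:
  assumes u: "u permutes {1..n}" and k: "k \<le> n"
    and v: "v \<in> {1..n - 1}" "v \<in> u ` {1..k}" "v + 1 \<notin> u ` {1..k}"
  shows "fire k v (config k u) = config k (simple_refl v \<circ> u)"
proof
  fix x
  show "fire k v (config k u) x = config k (simple_refl v \<circ> u) x"
  proof (cases "x = v")
    case False
    have "simple_refl v a \<le> x \<longleftrightarrow> a \<le> x" for a
      using False by (auto simp: simple_refl_def transpose_def)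
    then show ?thesis using False by (simp add: fire_def config_def)
  next
    case True
    obtain i where i: "i \<in> {1..k}" "u i = v" using v by force
    have inj: "u a = u b \<longleftrightarrow> a = b" for a b
      using permutes_inj[OF u] by (simp add: inj_eq)
    have "{j \<in> {1..k}. u j \<le> v} = insert i {j \<in> {1..k}. (simple_refl v \<circ> u) j \<le> v}"
      using i v(3) inj by (auto simp: simple_refl_def transpose_def split: if_splits) force+
    moreover have "i \<notin> {j \<in> {1..k}. (simple_refl v \<circ> u) j \<le> v}"
      using i by simp
    ultimately have count: "card {j \<in> {1..k}. u j \<le> v}
        = Suc (card {j \<in> {1..k}. (simple_refl v \<circ> u) j \<le> v})"
      by simp
    have "nbr_sum k (config k u) v = 2 * config k u v + 1"
      using nbr_sum_config[OF u k, of v] v by simp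
    moreover have "config k (simple_refl v \<circ> u) v = config k u v + 1"
      using count card_values_le[OF u k, of v] unfolding config_def by linarith
    ultimately show ?thesis
      using True by (simp add: fire_def)
  qed
qed

section \<open>Valid firing sequences and their permutations\<close>

lemma valid_from_snoc:
  "valid_from n k c (vs @ [v]) \<longleftrightarrow> valid_from n k c vs \<and> sad n k (fold (fire k) vs c) v"
  by (induction vs arbitrary: c) auto

lemma config_id: "config k id = (\<lambda>_. 0)"
proof
  fix v
  have "{i \<in> {1..k}. id i \<le> v} = {1..min k v}" by auto
  then show "config k id v = 0" by (simp add: config_def)
qed

lemma increasing_blocks_id: "increasing_blocks n k id"
  by (simp add: increasing_blocks_def permutes_id strict_mono_on_def)

lemma word_prod_rev_snoc: "word_prod (rev (vs @ [v])) = simple_refl v \<circ> word_prod (rev vs)"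
  by (simp add: word_prod_Cons)

text \<open>The invariant of the game, by induction on the last move: sadness is read off from
  \<open>config\<close>, and firing \<open>v\<close> then acts as left multiplication by
  \<open>simple_refl v\<close>.\<close>

lemma valid_firing_config:
  assumes k: "k \<le> n"
  shows "valid_firing n k vs \<Longrightarrow>
    increasing_blocks n k (word_prod (rev vs)) \<and>
    fold (fire k) vs (\<lambda>_. 0) = config k (word_prod (rev vs))"
proof (induction vs rule: rev_induct)
  case Nil
  have "fold (fire k) [] (\<lambda>_. 0) = (\<lambda>_. 0)" by simp
  then show ?case by (metis increasing_blocks_id config_id word_prod_Nil rev.simps(1))
next
  case (snoc v vs)
  define u where "u = word_prod (rev vs)"
  have IH: "increasing_blocks n k u" "fold (fire k) vs (\<lambda>_. 0) = config k u"
    using snoc by (auto simp: valid_firing_def valid_from_snoc u_def)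
  have p: "u permutes {1..n}" using IH by (simp add: increasing_blocks_def)
  have "sad n k (config k u) v"
    using snoc.prems IH by (simp add: valid_firing_def valid_from_snoc)
  then have v: "v \<in> {1..n - 1}" "v \<in> u ` {1..k}" "v + 1 \<notin> u ` {1..k}"
    using sad_config_iff[OF p k] by auto
  then have "increasing_blocks n k (simple_refl v \<circ> u)"
    using increasing_blocks_simple_refl[OF IH(1) v(1)] by simp
  moreover have "fold (fire k) (vs @ [v]) (\<lambda>_. 0) = config k (simple_refl v \<circ> u)"
    using fire_config[OF p k v] IH(2) by simp
  ultimately show ?case using word_prod_rev_snoc u_def by metis
qed

text \<open>Removes configurations from the remaining arguments: whether a move is legal depends on
  the values of the first block.\<close>

lemma valid_firing_snoc:
  assumes "k \<le> n"
  shows "valid_firing n k (vs @ [v]) \<longleftrightarrow> valid_firing n k vs \<and> v \<in> {1..n - 1} \<and>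
    v \<in> word_prod (rev vs) ` {1..k} \<and> v + 1 \<notin> word_prod (rev vs) ` {1..k}"
  using valid_firing_config[OF assms, of vs] sad_config_iff[OF _ assms, of "word_prod (rev vs)" v]
  by (auto simp: valid_firing_def valid_from_snoc increasing_blocks_def)

section \<open>Diagrams\<close>

lemma young_diagram_pos: "young_diagram D \<Longrightarrow> x \<in> D \<Longrightarrow> 1 \<le> fst x \<and> 1 \<le> snd x"
  by (auto simp: young_diagram_def diagram_def)

text \<open>Row lengths weakly decrease, so the row of \<open>x\<close> reaches at least as far as
  the row of \<open>y\<close>.\<close>

lemma young_diagram_down_closed:
  assumes D: "young_diagram D" "y \<in> D"
    and x: "1 \<le> fst x" "1 \<le> snd x" "fst x \<le> fst y" "snd x \<le> snd y"
  shows "x \<in> D"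
proof -
  obtain \<mu> where \<mu>: "sorted_wrt (\<ge>) \<mu>" "D = diagram \<mu>"
    using D by (auto simp: young_diagram_def is_partition_def)
  have y: "fst y \<le> length \<mu>" "snd y \<le> \<mu> ! (fst y - 1)"
    using D \<mu> by (auto simp: diagram_def)
  have "\<mu> ! (fst y - 1) \<le> \<mu> ! (fst x - 1)"
  proof (cases "fst x = fst y")
    case False
    then have "fst x - 1 < fst y - 1" "fst y - 1 < length \<mu>" using x y by linarith+
    then show ?thesis using sorted_wrt_nth_less[OF \<mu>(1)] by blast
  qed simp
  then show ?thesis using x y \<mu> by (auto simp: diagram_def split: prod.splits)
qed

text \<open>Of two distinct cells on one diagonal, one lies strictly above and to the left of the
  other, so the farther one cannot be added before the nearer one is present.\<close>

lemma addable_content_unique: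
  assumes x: "addable D x" and y: "addable D y" and c: "content x = content y"
  shows "x = y"
proof -
  have less: False if "addable D x" "addable D y" "content x = content y" "fst x < fst y" for x y
  proof -
    have "young_diagram (insert x D)" "young_diagram (insert y D)" "x \<notin> D"
      using that by (auto simp: addable_def)
    moreover have "snd x < snd y" using that by (simp add: content_def)
    ultimately have "x \<in> insert y D"
      using young_diagram_pos[of "insert x D" x] young_diagram_down_closed[of "insert y D" y x] that
      by simp
    then show False using \<open>x \<notin> D\<close> that by auto
  qed
  have "\<not> fst x < fst y" "\<not> fst y < fst x" using less[of x y] less[of y x] assms by auto
  then show ?thesis using c by (simp add: content_def prod_eq_iff)
qed

lemma next_cell_unique: "next_cell k i D x \<Longrightarrow> next_cell k i D y \<Longrightarrow> x = y"
  by (rule addable_content_unique) (auto simp: next_cell_def)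

text \<open>
  Row \<open>r\<close> belongs to position \<open>i = k + 1 - r\<close> and has length \<open>u i - i\<close>; the addition instead
  of a subtraction avoids truncation.
\<close>

definition cells :: "nat \<Rightarrow> (nat \<Rightarrow> nat) \<Rightarrow> (nat \<times> nat) set" where
  "cells k u = {(r, c). 1 \<le> r \<and> r \<le> k \<and> 1 \<le> c \<and> c + (k + 1 - r) \<le> u (k + 1 - r)}"

text \<open>In a weakly decreasing list the zeros form a suffix.\<close>

lemma filter_nonzero_eq_takeWhile:
  "sorted_wrt (\<ge>) xs \<Longrightarrow> filter (\<lambda>p. p \<noteq> (0::nat)) xs = takeWhile (\<lambda>p. p \<noteq> 0) xs"
  by (induction xs) (auto simp: filter_empty_conv)

text \<open>Zero rows contain no cells, and since they come last, dropping them does not shift any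
  other row.\<close>

lemma diagram_filter_nonzero:
  assumes "sorted_wrt (\<ge>) xs"
  shows "diagram (filter (\<lambda>p. p \<noteq> 0) xs) = diagram xs"
proof -
  let ?ys = "takeWhile (\<lambda>p. p \<noteq> 0) xs"
  have len: "length ?ys \<le> length xs" by (rule length_takeWhile_le)
  have "i < length ?ys" if "i < length xs" "xs ! i \<noteq> 0" for i
  proof (rule ccontr)
    assume i: "\<not> i < length ?ys"
    then have "xs ! length ?ys = 0"
      using nth_length_takeWhile[of "\<lambda>p. p \<noteq> 0" xs] that by simp
    then show False
      using sorted_wrt_nth_less[OF assms, of "length ?ys" i] that i
      by (metis le_zero_eq linorder_neqE_nat)
  qed
  then have "diagram ?ys = diagram xs"
    unfolding diagram_def using len takeWhile_nth[of _ "\<lambda>p. p \<noteq> 0" xs]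
    by (auto simp: Suc_le_eq) (metis One_nat_def Suc_pred diff_less le_trans less_eq_Suc_le
      not_less_eq_eq not_one_le_zero zero_less_one le_zero_eq)+
  then show ?thesis using filter_nonzero_eq_takeWhile[OF assms] by simp
qed

text \<open>Strictly increasing integers grow by at least one per step, so \<open>u i - i\<close>
  weakly increases in \<open>i\<close>; the rows are listed in reverse.\<close>

lemma sorted_row_lengths:
  assumes u: "increasing_blocks n k u"
  shows "sorted_wrt (\<ge>) (map (\<lambda>i. u i - i) (rev [1..<k + 1]))"
proof -
  have "u i - i \<le> u j - j" if "i \<in> {1..k}" "j \<in> {1..k}" "i < j" for i j
  proof -
    from that have "i \<le> j" "j \<le> k" "1 \<le> i" by auto
    then show ?thesis
    proof (induction j rule: dec_induct)
      case (step j)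
      have "u j < u (Suc j)" using u step strict_mono_onD[of "{1..k}" u] by (simp add: increasing_blocks_def)
      then show ?case using step by simp
    qed simp
  qed
  then show ?thesis
    unfolding rev_map[symmetric] sorted_wrt_rev sorted_wrt_map
    by (rule_tac sorted_wrt_mono_rel[OF _ sorted_wrt_upt]) auto
qed

lemma is_partition_shape: "increasing_blocks n k u \<Longrightarrow> is_partition (shape k u)"
  unfolding is_partition_def shape_def
  using sorted_wrt_filter[OF sorted_row_lengths] by (simp del: upt_Suc)

lemma diagram_shape:
  assumes u: "increasing_blocks n k u"
  shows "diagram (shape k u) = cells k u"
proof -
  have "rev [1..<k + 1] ! (r - 1) = k + 1 - r" if "1 \<le> r" "r \<le> k" for r
    using that by (simp add: rev_nth del: upt_Suc)
  then have "diagram (map (\<lambda>i. u i - i) (rev [1..<k + 1])) = cells k u"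
    unfolding diagram_def cells_def by (auto simp del: upt_Suc)
  then show ?thesis
    unfolding shape_def diagram_filter_nonzero[OF sorted_row_lengths[OF u]] .
qed

lemma young_diagram_cells: "increasing_blocks n k u \<Longrightarrow> young_diagram (cells k u)"
  unfolding young_diagram_def using is_partition_shape diagram_shape by metis

text \<open>Among the positions in \<open>{1..k}\<close> only \<open>i\<close> carries
  \<open>v\<close> or \<open>v + 1\<close>, so its row alone changes, and it grows by one
  cell.\<close>

lemma cells_simple_refl:
  assumes u: "increasing_blocks n k u" and i: "i \<in> {1..k}" "u i = v" and v: "v + 1 \<notin> u ` {1..k}"
  shows "cells k (simple_refl v \<circ> u) = insert (k + 1 - i, v + 1 - i) (cells k u)"
    and "(k + 1 - i, v + 1 - i) \<notin> cells k u"
proof -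
  \<comment> \<open>Ensures that the column \<open>v + 1 - i\<close> is not truncated and is at
    least 1.\<close>
  have iv: "i \<le> v" using increasing_blocks_ge[OF u, of i] i by simp
  have inj: "u a = u b \<longleftrightarrow> a = b" for a b
    using u by (metis increasing_blocks_def inj_eq permutes_inj)
  show "(k + 1 - i, v + 1 - i) \<notin> cells k u"
    using i iv by (simp add: cells_def)
  show "cells k (simple_refl v \<circ> u) = insert (k + 1 - i, v + 1 - i) (cells k u)"
  proof -
    have "(r, c) \<in> cells k (simple_refl v \<circ> u) \<longleftrightarrow>
        (r, c) \<in> insert (k + 1 - i, v + 1 - i) (cells k u)" for r c
    proof (cases "1 \<le> r \<and> r \<le> k")
      case True
      define j where "j = k + 1 - r"
      have j: "j \<in> {1..k}" "r = k + 1 - j" using True by (auto simp: j_def)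
      show ?thesis
      proof (cases "j = i")
        case True
        then show ?thesis using i iv j unfolding cells_def
          by (auto simp: simple_refl_def)
      next
        case False
        then have "r \<noteq> k + 1 - i" using i j by auto
        moreover have "u j \<noteq> v" "u j \<noteq> v + 1"
          using inj[of j i] False i v imageI[OF j(1), of u] by metis+
        then have "simple_refl v (u j) = u j" by (simp add: simple_refl_def)
        ultimately show ?thesis unfolding cells_def using j_def by simp
      qed
    qed (use i in \<open>auto simp: cells_def\<close>)
    then show ?thesis by (simp add: set_eq_iff)
  qed
qed

text \<open>The position \<open>i\<close> cancels in the content
  \<open>(v + 1 - i) - (k + 1 - i)\<close>; both cell sets come from permutations increasing on the
  blocks.\<close>

lemma next_cell_cells:
  assumes u: "increasing_blocks n k u" and i: "i \<in> {1..k}" "u i = v"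
    and v: "v \<in> {1..n - 1}" "v + 1 \<notin> u ` {1..k}"
  shows "next_cell k v (cells k u) (k + 1 - i, v + 1 - i)"
proof -
  have "increasing_blocks n k (simple_refl v \<circ> u)"
    using increasing_blocks_simple_refl[OF u v(1)] v i by blast
  moreover have "content (k + 1 - i, v + 1 - i) = int v - int k"
    using increasing_blocks_ge[OF u, of i] i by (simp add: content_def of_nat_diff)
  ultimately show ?thesis
    using young_diagram_cells u cells_simple_refl[OF u i v(2)]
    unfolding next_cell_def addable_def by metis
qed

section \<open>Fillings\<close>

lemma filling_upto_append: "j \<le> length vs \<Longrightarrow> filling_upto k (vs @ ws) j = filling_upto k vs j"
  by (induction j) (auto simp: Let_def nth_append)

lemma filling_upto_eq_filling_take: "j \<le> length vs \<Longrightarrow> filling_upto k vs j = filling k (take j vs)"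
  using filling_upto_append[of j "take j vs" k "drop j vs"] by (simp add: filling_def)

text \<open>Uniqueness of the next cell evaluates the definite description, so any witness
  \<open>x\<close> may be supplied.\<close>

lemma filling_snoc:
  assumes "next_cell k v (dom (filling k vs)) x"
  shows "filling k (vs @ [v]) = (filling k vs)(x \<mapsto> Suc (length vs))"
proof -
  have "(THE x. next_cell k v (dom (filling k vs)) x) = x"
    using assms next_cell_unique by blast
  then show ?thesis
    using filling_upto_append[of "length vs" vs k "[v]"] by (simp add: filling_def Let_def nth_append)
qed

text \<open>One induction on the last move carries all clauses. The inversion count ties the length
  of the sequence to the Coxeter length; the componentwise order yields rows and columns at once;
  the content clause lets the filling be decoded.\<close>

lemma valid_firing_filling:
  assumes k: "k \<le> n"
  shows "valid_firing n k vs \<Longrightarrow>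
    dom (filling k vs) = cells k (word_prod (rev vs)) \<and>
    card (inversions n (word_prod (rev vs))) = length vs \<and>
    bij_betw (\<lambda>x. the (filling k vs x)) (dom (filling k vs)) {1..length vs} \<and>
    (\<forall>x\<in>dom (filling k vs). \<forall>y\<in>dom (filling k vs).
       fst x \<le> fst y \<and> snd x \<le> snd y \<and> x \<noteq> y \<longrightarrow> the (filling k vs x) < the (filling k vs y)) \<and>
    (\<forall>x\<in>dom (filling k vs). content x = int (vs ! (the (filling k vs x) - 1)) - int k)"
proof (induction vs rule: rev_induct)
  case Nil
  have "cells k id = {}" by (auto simp: cells_def)
  then show ?case
    by (simp only: rev.simps word_prod_Nil inversions_id) (simp add: filling_def bij_betw_def)
next
  case (snoc v vs)
  define u where "u = word_prod (rev vs)"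
  define T where "T = filling k vs"
  define m where "m = length vs"
  have "valid_firing n k vs" and v: "v \<in> {1..n - 1}" "v \<in> u ` {1..k}" "v + 1 \<notin> u ` {1..k}"
    using snoc.prems valid_firing_snoc[OF k] by (auto simp: u_def)
  then have u: "increasing_blocks n k u" and
    IH: "dom T = cells k u" "card (inversions n u) = m"
      "bij_betw (\<lambda>x. the (T x)) (dom T) {1..m}"
      "\<And>x y. x \<in> dom T \<Longrightarrow> y \<in> dom T \<Longrightarrow> fst x \<le> fst y \<Longrightarrow> snd x \<le> snd y \<Longrightarrow> x \<noteq> y \<Longrightarrow>
        the (T x) < the (T y)"
      "\<And>x. x \<in> dom T \<Longrightarrow> content x = int (vs ! (the (T x) - 1)) - int k"
    using snoc.IH valid_firing_config[OF k] unfolding u_def T_def m_def by blast+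
  obtain i where i: "i \<in> {1..k}" "u i = v" using v by force
  define z where "z = (k + 1 - i, v + 1 - i)"
  have p: "u permutes {1..n}" using u by (simp add: increasing_blocks_def)
  have nc: "next_cell k v (dom T) z"
    using next_cell_cells[OF u i v(1) v(3)] by (simp add: z_def IH)
  have T': "filling k (vs @ [v]) = T(z \<mapsto> Suc m)"
    using filling_snoc nc by (simp add: T_def m_def)
  have z: "z \<notin> dom T" using nc by (simp add: next_cell_def addable_def)
  have range: "the (T x) \<in> {1..m}" if "x \<in> dom T" for x
    using bij_betwE[OF IH(3)] that by blast
  have "cells k (simple_refl v \<circ> u) = dom (T(z \<mapsto> Suc m))"
    using cells_simple_refl(1)[OF u i v(3)] by (simp add: z_def IH)
  moreover have "card (inversions n (simple_refl v \<circ> u)) = Suc m"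
  proof -
    \<comment> \<open>Since \<open>v + 1\<close> is not a value of the first block, its position
      \<open>q\<close> lies beyond \<open>k\<close> and hence to the right of
      \<open>i\<close>.\<close>
    have "v + 1 \<in> u ` {1..n}" using v permutes_image[OF p] by auto
    then obtain q where q: "q \<in> {1..n}" "u q = v + 1" by force
    then have "q \<notin> {1..k}" using v(3) by (metis imageI)
    then have "i < q" "i \<in> {1..n}" using i q k by auto
    then show ?thesis using card_inversions_simple_refl[OF p, of i q v] i q IH by simp
  qed
  moreover have "bij_betw (\<lambda>x. the ((T(z \<mapsto> Suc m)) x)) (dom (T(z \<mapsto> Suc m))) {1..Suc m}"
  proof -
    have "bij_betw (\<lambda>x. the ((T(z \<mapsto> Suc m)) x)) (dom T) {1..m}"
      using IH(3) z by (subst bij_betw_cong[where g = "\<lambda>x. the (T x)"]) auto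
    moreover have "bij_betw (\<lambda>x. the ((T(z \<mapsto> Suc m)) x)) {z} {Suc m}"
      by (simp add: bij_betw_def)
    ultimately have "bij_betw (\<lambda>x. the ((T(z \<mapsto> Suc m)) x)) (dom T \<union> {z}) ({1..m} \<union> {Suc m})"
      by (rule bij_betw_combine) simp
    moreover have "dom T \<union> {z} = dom (T(z \<mapsto> Suc m))" "{1..m} \<union> {Suc m} = {1..Suc m}" by auto
    ultimately show ?thesis by simp
  qed
  moreover have "the ((T(z \<mapsto> Suc m)) x) < the ((T(z \<mapsto> Suc m)) y)"
    if "x \<in> dom (T(z \<mapsto> Suc m))" "y \<in> dom (T(z \<mapsto> Suc m))" "fst x \<le> fst y" "snd x \<le> snd y" "x \<noteq> y"
    for x y
  proof (cases "x = z")
    \<comment> \<open>This case is contradictory: an old cell weakly below and to the right of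
      \<open>z\<close> would force \<open>z\<close> into the old diagram.\<close>
    case True
    then have "y \<in> dom T" using that by auto
    moreover have "young_diagram (dom T)" "1 \<le> fst z \<and> 1 \<le> snd z"
      using nc young_diagram_pos[of "insert z (dom T)" z] by (auto simp: next_cell_def addable_def)
    ultimately have "z \<in> dom T" using young_diagram_down_closed that True by blast
    then show ?thesis using z by simp
  next
    case False
    then have x: "x \<in> dom T" using that by auto
    show ?thesis
    proof (cases "y = z")
      case True
      then show ?thesis using False range[OF x] by simp
    next
      case False
      then show ?thesis using x \<open>x \<noteq> z\<close> IH(4)[of x y] that by auto
    qed
  qed
  moreover have "content x = int ((vs @ [v]) ! (the ((T(z \<mapsto> Suc m)) x) - 1)) - int k"
    if "x \<in> dom (T(z \<mapsto> Suc m))" for x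
  proof (cases "x = z")
    case True
    then show ?thesis using nc by (simp add: next_cell_def m_def)
  next
    case False
    then have x: "x \<in> dom T" using that by auto
    have "the (T x) - 1 < length vs" using range[OF x] by (auto simp: m_def)
    then show ?thesis using False IH(5)[OF x] by (simp add: nth_append)
  qed
  moreover have len: "length (vs @ [v]) = Suc m" by (simp add: m_def)
  moreover have prod: "word_prod (rev (vs @ [v])) = simple_refl v \<circ> u"
    unfolding u_def by (rule word_prod_rev_snoc)
  ultimately show ?case by (simp only: T' len prod) blast
qed

section \<open>Standard Young tableaux and the inverse of the filling map\<close>

lemma SYT_D:
  assumes "T \<in> SYT \<mu>"
  shows "dom T = diagram \<mu>" "bij_betw (\<lambda>x. the (T x)) (diagram \<mu>) {1..card (diagram \<mu>)}"
    "\<And>r c c'. (r, c) \<in> diagram \<mu> \<Longrightarrow> (r, c') \<in> diagram \<mu> \<Longrightarrow> c < c' \<Longrightarrow> the (T (r, c)) < the (T (r, c'))"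
    "\<And>r r' c. (r, c) \<in> diagram \<mu> \<Longrightarrow> (r', c) \<in> diagram \<mu> \<Longrightarrow> r < r' \<Longrightarrow> the (T (r, c)) < the (T (r', c))"
  using assms by (auto simp: SYT_def)

lemma filling_in_SYT:
  assumes k: "k \<le> n" and vs: "valid_firing n k vs"
  shows "filling k vs \<in> SYT (shape k (word_prod (rev vs)))"
proof -
  have "increasing_blocks n k (word_prod (rev vs))" using valid_firing_config[OF k vs] by simp
  then have d: "diagram (shape k (word_prod (rev vs))) = dom (filling k vs)"
    using diagram_shape valid_firing_filling[OF k vs] by simp
  have b: "bij_betw (\<lambda>x. the (filling k vs x)) (dom (filling k vs)) {1..length vs}"
    using valid_firing_filling[OF k vs] by blast
  moreover have "card (dom (filling k vs)) = length vs"
    using bij_betw_same_card[OF b] by simp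
  ultimately show ?thesis
    unfolding SYT_def d using valid_firing_filling[OF k vs] by auto
qed

text \<open>The content of the cell holding \<open>Suc j\<close> determines \<open>vs ! j\<close>,
  and the number of filled cells determines the length.\<close>

lemma filling_inj:
  assumes k: "k \<le> n" and vs: "valid_firing n k vs" "valid_firing n k vs'"
    and eq: "filling k vs = filling k vs'"
  shows "vs = vs'"
proof -
  have *: "\<exists>x\<in>dom (filling k vs). the (filling k vs x) = Suc j \<and> content x = int (vs ! j) - int k"
    if "valid_firing n k vs" "j < length vs" for vs j
  proof -
    have "Suc j \<in> (\<lambda>x. the (filling k vs x)) ` dom (filling k vs)"
      using valid_firing_filling[OF k that(1)] that(2) bij_betw_imp_surj_on by fastforce
    then obtain x where "x \<in> dom (filling k vs)" "the (filling k vs x) = Suc j" by force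
    then show ?thesis using valid_firing_filling[OF k that(1)] by (intro bexI[of _ x]) auto
  qed
  have b: "bij_betw (\<lambda>x. the (filling k vs x)) (dom (filling k vs)) {1..length vs}"
    "bij_betw (\<lambda>x. the (filling k vs x)) (dom (filling k vs)) {1..length vs'}"
    using valid_firing_filling[OF k vs(1)] valid_firing_filling[OF k vs(2)] eq by auto
  then have len: "length vs = length vs'"
    using bij_betw_same_card by (metis card_atLeastAtMost diff_Suc_1)
  show ?thesis
  proof (rule nth_equalityI[OF len])
    fix j assume j: "j < length vs"
    obtain x where x: "x \<in> dom (filling k vs)" "the (filling k vs x) = Suc j"
        "content x = int (vs ! j) - int k"
      using *[OF vs(1) j] by blast
    obtain y where y: "y \<in> dom (filling k vs)" "the (filling k vs y) = Suc j"
        "content y = int (vs' ! j) - int k"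
      using *[OF vs(2)] j len eq by metis
    have "x = y" using b(1) x y by (auto simp: bij_betw_def inj_on_def)
    then show "vs ! j = vs' ! j" using x y by simp
  qed
qed

text \<open>The cell of the largest entry is a corner. Being last in its row it determines
  \<open>w i\<close>, and having no cell below it keeps \<open>w i - 1\<close> out of the first
  block, which is what undoing a move requires.\<close>

lemma SYT_remove_max:
  assumes w: "increasing_blocks n k w" and k: "k \<le> n" and T: "T \<in> SYT (shape k w)"
    and card: "card (cells k w) = Suc m"
  obtains v i where "v \<in> {1..n - 1}" "i \<in> {1..k}" "w i = v + 1" "v \<notin> w ` {1..k}"
    "(k + 1 - i, v + 1 - i) \<in> cells k w" "the (T (k + 1 - i, v + 1 - i)) = Suc m"
proof -
  note T' = SYT_D[OF T, unfolded diagram_shape[OF w]]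
  have bij: "bij_betw (\<lambda>x. the (T x)) (cells k w) {1..Suc m}" using T' card by simp
  then have "Suc m \<in> (\<lambda>x. the (T x)) ` cells k w" by (simp add: bij_betw_def)
  then obtain r c where rc: "(r, c) \<in> cells k w" "the (T (r, c)) = Suc m" by force
  have le: "the (T x) \<le> Suc m" if "x \<in> cells k w" for x
    using bij_betwE[OF bij] that by auto
  have p: "w permutes {1..n}" using w by (simp add: increasing_blocks_def)
  define i where "i = k + 1 - r"
  have i: "i \<in> {1..k}" "r = k + 1 - i" and c: "1 \<le> c" "c + i \<le> w i"
    using rc by (auto simp: cells_def i_def)
  have wi: "w i = c + i"
  proof (rule ccontr)
    assume "w i \<noteq> c + i"
    then have "(r, c + 1) \<in> cells k w" using i c by (auto simp: cells_def)
    then show False using T'(3)[of r c "c + 1"] le[of "(r, c + 1)"] rc by simp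
  qed
  define v where "v = c + i - 1"
  have "w i \<in> {1..n}" using permutes_in_image[OF p] i k by simp
  then have v: "v \<in> {1..n - 1}" "w i = v + 1" "c = v + 1 - i"
    using wi i c by (auto simp: v_def)
  have "v \<notin> w ` {1..k}"
  proof
    assume "v \<in> w ` {1..k}"
    then obtain j where j: "j \<in> {1..k}" "w j = v" by force
    have mono: "w a < w b" if "a \<in> {1..k}" "b \<in> {1..k}" "a < b" for a b
      using w that strict_mono_onD unfolding increasing_blocks_def by blast
    have "j < i" using mono[of i j] j i v by (metis less_add_one less_asym linorder_neqE_nat)
    then have i2: "i - 1 \<in> {1..k}" "j \<le> i - 1" using j i by auto
    \<comment> \<open>Monotonicity squeezes \<open>w (i - 1)\<close> between \<open>w j = v\<close>
      and \<open>w i = v + 1\<close>; the next row then reaches column \<open>c\<close>, giving a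
      cell below the maximum.\<close>
    have "w (i - 1) = v"
      using mono[of "i - 1" i] mono[of j "i - 1"] i2 j i v by (cases "j = i - 1") auto
    moreover have "r + 1 \<le> k" "k + 1 - (r + 1) = i - 1" using i i2 by auto
    ultimately have "(r + 1, c) \<in> cells k w" using i2 v c by (simp add: cells_def)
    then show False using T'(4)[of r c "r + 1"] le[of "(r + 1, c)"] rc by simp
  qed
  then show ?thesis using that[of v i] v i rc by simp
qed

text \<open>Induction on the number of cells: erase the largest entry, undo the corresponding move
  on \<open>w\<close>, and append the vertex \<open>v\<close> to the sequence found for the smaller
  tableau.\<close>

lemma filling_surj:
  assumes k: "k \<le> n"
  shows "increasing_blocks n k w \<Longrightarrow> T \<in> SYT (shape k w) \<Longrightarrow> card (cells k w) = m \<Longrightarrow>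
    \<exists>vs. valid_firing n k vs \<and> word_prod (rev vs) = w \<and> filling k vs = T"
proof (induction m arbitrary: w T)
  case 0
  note T = SYT_D[OF 0(2), unfolded diagram_shape[OF 0(1)]]
  have p: "w permutes {1..n}" using 0(1) by (simp add: increasing_blocks_def)
  have empty: "cells k w = {}" using T(2) 0(3) by (simp add: bij_betw_def)
  have "w i = i" if "i \<in> {1..k}" for i
  proof (rule ccontr)
    assume "w i \<noteq> i"
    then have "(k + 1 - i, 1) \<in> cells k w"
      using increasing_blocks_ge[OF 0(1), of i] that by (auto simp: cells_def)
    then show False using empty by simp
  qed
  then have fix_k: "\<And>i. i \<le> k \<Longrightarrow> w i = i"
    using permutes_not_in[OF p] by (metis atLeastAtMost_iff less_one linorder_not_le)
  have "strict_mono_on {1..n} w"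
  proof (rule strict_mono_on_atLeastAtMostI)
    fix i assume i: "1 \<le> i" "i < n"
    consider "Suc i \<le> k" | "i = k" | "k < i" by linarith
    then show "w i < w (Suc i)"
    proof cases
      case 2
      \<comment> \<open>At the junction of the two blocks, the values up to \<open>k\<close> are
        already taken by fixed points.\<close>
      have "\<not> w (Suc k) \<le> k"
      proof
        assume "w (Suc k) \<le> k"
        then have "w (w (Suc k)) = w (Suc k)" by (rule fix_k)
        then have "w (Suc k) = Suc k" using permutes_inj[OF p] by (simp add: inj_eq)
        then show False using \<open>w (Suc k) \<le> k\<close> by simp
      qed
      then show ?thesis using 2 fix_k[of k] by simp
    next
      case 3
      then show ?thesis using 0(1) i strict_mono_onD[of "{k + 1..n}" w] by (simp add: increasing_blocks_def)
    qed (simp add: fix_k)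
  qed
  then have "w = id" using strict_mono_permutes_imp_id p by blast
  moreover have "T = Map.empty" using T(1) empty by simp
  ultimately show ?case
    by (intro exI[of _ "[]"]) (simp add: valid_firing_def word_prod_def filling_def)
next
  case (Suc m)
  note w = \<open>increasing_blocks n k w\<close>
  obtain v i where v: "v \<in> {1..n - 1}" "v \<notin> w ` {1..k}" and i: "i \<in> {1..k}" "w i = v + 1"
    and z: "(k + 1 - i, v + 1 - i) \<in> cells k w" "the (T (k + 1 - i, v + 1 - i)) = Suc m"
    using SYT_remove_max[OF w k Suc.prems(2,3)] by metis
  define z where "z = (k + 1 - i, v + 1 - i)"
  \<comment> \<open>The permutation before the last move: it carries \<open>v\<close> at position
    \<open>i\<close>, where \<open>w\<close> carries \<open>v + 1\<close>.\<close>
  define u where "u = simple_refl v \<circ> w"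
  have w_eq: "w = simple_refl v \<circ> u" by (simp add: u_def)
  have "v + 1 \<in> w ` {1..k}" using i by (metis imageI)
  then have u: "increasing_blocks n k u"
    unfolding u_def using increasing_blocks_simple_refl[OF w v(1)] v by simp
  have ui: "u i = v" using i by (simp add: u_def simple_refl_def)
  have v1: "v + 1 \<notin> u ` {1..k}"
  proof
    assume "v + 1 \<in> u ` {1..k}"
    then obtain j where j: "j \<in> {1..k}" "simple_refl v (w j) = v + 1" by (auto simp: u_def)
    then have "w j = v" by (metis simple_refl_involutory simple_refl_def transpose_apply_second)
    then show False using v j by blast
  qed
  have cells: "cells k w = insert z (cells k u)" "z \<notin> cells k u"
    using cells_simple_refl[OF u i(1) ui v1] by (simp_all add: w_eq[symmetric] z_def)
  note T = SYT_D[OF Suc.prems(2), unfolded diagram_shape[OF w]]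
  define T' where "T' = T(z := None)"
  have fin: "finite (cells k w)" using Suc.prems(3) by (metis card.infinite nat.distinct(1))
  have card: "card (cells k u) = m" using Suc.prems(3) cells fin by simp
  have "dom T' = cells k u" using T(1) cells by (auto simp: T'_def)
  moreover have "bij_betw (\<lambda>x. the (T' x)) (cells k u) {1..m}"
  proof -
    have "bij_betw (\<lambda>x. the (T x)) (cells k w - {z}) ({1..Suc m} - {the (T z)})"
      using T(2) Suc.prems(3) z by (intro bij_betw_DiffI) (auto simp: z_def)
    moreover have "cells k w - {z} = cells k u" "{1..Suc m} - {the (T z)} = {1..m}"
      using cells z by (auto simp: z_def)
    ultimately show ?thesis
      using cells(2) by (subst bij_betw_cong[where g = "\<lambda>x. the (T x)"]) (auto simp: T'_def)
  qed
  moreover have "T' x = T x" if "x \<in> cells k u" for x using that cells by (auto simp: T'_def)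
  ultimately have "T' \<in> SYT (shape k u)"
    unfolding SYT_def diagram_shape[OF u] using T(3,4) cells(1) card by auto
  then obtain vs where vs: "valid_firing n k vs" "word_prod (rev vs) = u" "filling k vs = T'"
    using Suc.IH[OF u _ card] by blast
  have "length vs = m"
    using bij_betw_same_card[of _ "dom (filling k vs)" "{1..length vs}"] valid_firing_filling[OF k vs(1)]
      vs(2) card by force
  moreover have "next_cell k v (dom (filling k vs)) z"
    using next_cell_cells[OF u i(1) ui v(1) v1] valid_firing_filling[OF k vs(1)] vs(2)
    by (simp add: z_def)
  ultimately have "filling k (vs @ [v]) = T'(z \<mapsto> Suc m)" using filling_snoc vs(3) by metis
  moreover have "T z = Some (Suc m)"
  proof -
    have "z \<in> dom T" using T(1) cells(1) by simp
    then show ?thesis using z by (auto simp: z_def)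
  qed
  ultimately have "filling k (vs @ [v]) = T" by (auto simp: T'_def fun_eq_iff)
  moreover have "valid_firing n k (vs @ [v])"
    using valid_firing_snoc[OF k] vs v v1 ui i by (metis imageI)
  moreover have "word_prod (rev (vs @ [v])) = w"
    using w_eq vs(2) word_prod_rev_snoc by simp
  ultimately show ?case by blast
qed

lemma valid_firing_take: "valid_firing n k vs \<Longrightarrow> valid_firing n k (take j vs)"
proof -
  have "valid_from n k c vs \<Longrightarrow> valid_from n k c (take j vs)" for c
    by (induction vs arbitrary: c j) (auto simp: take_Cons split: nat.splits)
  then show "valid_firing n k vs \<Longrightarrow> valid_firing n k (take j vs)" by (simp add: valid_firing_def)
qed

text \<open>The prefix of length \<open>Suc j\<close> is itself valid, so its last move supplies the
  cell; contents give uniqueness.\<close>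

lemma ex1_next_cell:
  assumes k: "k \<le> n" and vs: "valid_firing n k vs" and j: "j < length vs"
  shows "\<exists>!x. next_cell k (vs ! j) (dom (filling_upto k vs j)) x"
proof -
  define us where "us = take j vs"
  define v where "v = vs ! j"
  define u where "u = word_prod (rev us)"
  have "valid_firing n k (us @ [v])"
    using valid_firing_take[OF vs, of "Suc j"] j by (simp add: us_def v_def take_Suc_conv_app_nth)
  then have us: "valid_firing n k us" and v: "v \<in> {1..n - 1}" "v \<in> u ` {1..k}" "v + 1 \<notin> u ` {1..k}"
    using valid_firing_snoc[OF k] by (auto simp: u_def)
  obtain i where "i \<in> {1..k}" "u i = v" using v by force
  then have "next_cell k v (cells k u) (k + 1 - i, v + 1 - i)"
    using next_cell_cells[of n k u] valid_firing_config[OF k us] v by (simp add: u_def)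
  moreover have "dom (filling_upto k vs j) = cells k u"
    using filling_upto_eq_filling_take[of j vs k] j valid_firing_filling[OF k us] by (simp add: us_def u_def)
  ultimately show ?thesis using next_cell_unique unfolding v_def by metis
qed

theorem theorem3p15:
  fixes n k :: nat and w :: "nat \<Rightarrow> nat"
  assumes "n \<ge> 2" and "1 \<le> k" and "k \<le> n - 1"
    and "w \<in> grassmannian n k"
  shows "(\<forall>vs\<in>firing_seqs n k w. \<forall>j<length vs.
            \<exists>!x. next_cell k (vs ! j) (dom (filling_upto k vs j)) x)
       \<and> bij_betw (filling k) (firing_seqs n k w) (SYT (shape k w))"
proof -
  have k: "k \<le> n" using assms by simp
  have w: "increasing_blocks n k w"
    using grassmannian_imp_increasing_blocks assms by blast
  then have len: "cox_length n w = card (inversions n w)"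
    by (simp add: cox_length_eq_card_inversions increasing_blocks_def)
  \<comment> \<open>The inversion count identifies the length of a valid sequence producing
    \<open>w\<close> with the Coxeter length of \<open>w\<close>.\<close>
  have seqs: "firing_seqs n k w = {vs. valid_firing n k vs \<and> word_prod (rev vs) = w}"
    using valid_firing_filling[OF k] len by (auto simp: firing_seqs_def)
  have "inj_on (filling k) (firing_seqs n k w)"
    unfolding seqs using filling_inj[OF k] by (auto intro: inj_onI)
  moreover have "filling k ` firing_seqs n k w = SYT (shape k w)"
    unfolding seqs using filling_in_SYT[OF k] filling_surj[OF k w] by fast
  ultimately show ?thesis
    using ex1_next_cell[OF k] by (simp add: bij_betw_def seqs)
qed

end
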